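(* Let $N\ge1$ be an integer. If $\varphi_1,\varphi_2\in S_N$ and $g_1,g_2\in S_0(\mathbb{R})$, then $$\int_{\mathbb{T}_N^2}\mathbf{V}_{g_1}\varphi_1(x,\xi)\,\overline{\mathbf{V}_{g_2}\varphi_2(x,\xi)}\,dx\,d\xi=N\langle\varphi_1,\varphi_2\rangle_{S_N}\langle g_2,g_1\rangle_{L^2}.$$
   Context: For $x,\xi\in\mathbb{R}$ let $\mathbf{T}_x f(t)=f(t-x)$, $\mathbf{M}_\xi f(t)=e^{2\pi i\xi t}f(t)$ and $\pi(x,\xi)=\mathbf{M}_\xi\mathbf{T}_x$. For $f,g\in L^2(\mathbb{R})$ the short-time Fourier transform (STFT) is $\mathbf{V}_g f(x,\xi)=\langle f,\pi(x,\xi)g\rangle$. With $h_0(t)=e^{-\pi t^2}$, the Feichtinger algebra is $S_0(\mathbb{R})=\{f\in L^2(\mathbb{R}):\mathbf{V}_{h_0}f\in L^1(\mathbb{R}^2)\}$ with norm $\|f\|_{S_0}=\|\mathbf{V}_{h_0}f\|_{L^1(\mathbb{R}^2)}$; its dual is $S_0'(\mathbb{R})$. The duality pairing $\langle\cdot,\cdot\rangle_{S_0'\times S_0}$ is linear in the first and antilinear in the second argument (so $\langle\delta_t,g\rangle=\overline{g(t)}$). For $\varphi\in S_0'(\mathbb{R})$ and $g\in S_0(\mathbb{R})$, the STFT is $\mathbf{V}_g\varphi(x,\xi)=\langle\varphi,\pi(x,\xi)g\rangle_{S_0'\times S_0}$. $S_N\subset S_0'(\mathbb{R})$ is the linear span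 of the delta trains $\epsilon_n=\sum_{k\in\mathbb{Z}}\delta_{\frac nN+k}$, $n=0,\dots,N-1$, which form a basis of $S_N$. For $\varphi=\sum_{n=0}^{N-1}a_n\epsilon_n$ and $\psi=\sum_{n=0}^{N-1}b_n\epsilon_n$ one sets $\langle\varphi,\psi\rangle_{S_N}=\sum_{n=0}^{N-1}a_n\overline{b_n}$. $\mathbb{T}_N^2=\mathbb{R}^2/(\mathbb{Z}\times N\mathbb{Z})$, represented by $[0,1]\times[0,N]$, and integrals over $\mathbb{T}_N^2$ are integrals over $x\in[0,1]$, $\xi\in[0,N]$. The inner product $\langle f,g\rangle_{L^2}=\int f\overline g$ is antilinear in the second argument. *)

theory Defs
  imports "HOL-Analysis.Analysis"
begin

definition translate :: "real \<Rightarrow> (real \<Rightarrow> complex) \<Rightarrow> real \<Rightarrow> complex" where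
  "translate x f t = f (t - x)"

definition modulate :: "real \<Rightarrow> (real \<Rightarrow> complex) \<Rightarrow> real \<Rightarrow> complex" where
  "modulate \<xi> f t = exp (2 * of_real pi * \<i> * of_real \<xi> * of_real t) * f t"

definition tf_shift :: "real \<Rightarrow> real \<Rightarrow> (real \<Rightarrow> complex) \<Rightarrow> real \<Rightarrow> complex" where
  "tf_shift x \<xi> f = modulate \<xi> (translate x f)"

text \<open>Elements of \<open>L\<^sup>2(\<real>)\<close> are represented by Borel measurable functions; functions that agree
  almost everywhere are not identified.\<close>

definition L2 :: "(real \<Rightarrow> complex) set" where
  "L2 = {f. f \<in> borel_measurable lborel \<and> integrable lborel (\<lambda>t. (cmod (f t))\<^sup>2)}"

definition L2_inner :: "(real \<Rightarrow> complex) \<Rightarrow> (real \<Rightarrow> complex) \<Rightarrow> complex" where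
  "L2_inner f g = (LINT t|lborel. f t * cnj (g t))"

definition stft :: "(real \<Rightarrow> complex) \<Rightarrow> (real \<Rightarrow> complex) \<Rightarrow> real \<Rightarrow> real \<Rightarrow> complex" where
  "stft g f x \<xi> = L2_inner f (tf_shift x \<xi> g)"

definition gauss :: "real \<Rightarrow> complex" where
  "gauss t = of_real (exp (- pi * t\<^sup>2))"

definition S0 :: "(real \<Rightarrow> complex) set" where
  "S0 = {f \<in> L2. integrable (lborel :: (real \<times> real) measure) (\<lambda>(x, \<xi>). stft gauss f x \<xi>)}"

text \<open>Point evaluation on \<open>S0\<close> refers to the continuous representative, which exists for
  every element of \<open>S0\<close> and is unique.\<close>

definition cont_rep :: "(real \<Rightarrow> complex) \<Rightarrow> real \<Rightarrow> complex" where
  "cont_rep g = (THE h. continuous_on UNIV h \<and> (AE t in lborel. h t = g t))"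

text \<open>A distribution \<open>\<phi>\<close> in the dual of \<open>S0\<close> is represented by the antilinear functional
  \<open>g \<mapsto> \<langle>\<phi>, g\<rangle>\<close>, extended by \<open>0\<close> outside \<open>S0\<close>. Equality of distributions is then equality of
  functions, and the duality pairing is function application.\<close>

type_synonym distribution = "(real \<Rightarrow> complex) \<Rightarrow> complex"

definition delta :: "real \<Rightarrow> distribution" where
  "delta t g = (if g \<in> S0 then cnj (cont_rep g t) else 0)"

definition stft_dual :: "(real \<Rightarrow> complex) \<Rightarrow> distribution \<Rightarrow> real \<Rightarrow> real \<Rightarrow> complex" where
  "stft_dual g \<phi> x \<xi> = \<phi> (tf_shift x \<xi> g)"

text \<open>The series of point masses is taken in the weak-* sense, i.e. pointwise on \<open>S0\<close>.\<close>

definition delta_train :: "nat \<Rightarrow> nat \<Rightarrow> distribution" where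
  "delta_train N n g = (\<Sum>\<^sub>\<infinity>k\<in>(UNIV :: int set). delta (real n / real N + of_int k) g)"

definition train_comb :: "nat \<Rightarrow> (nat \<Rightarrow> complex) \<Rightarrow> distribution" where
  "train_comb N a g = (\<Sum>n<N. a n * delta_train N n g)"

definition SN :: "nat \<Rightarrow> distribution set" where
  "SN N = range (train_comb N)"

text \<open>The delta trains are linearly independent, so for \<open>\<phi> \<in> SN N\<close> the coefficients with index
  below \<open>N\<close> do not depend on the choice; the others are never used.\<close>

definition SN_coeff :: "nat \<Rightarrow> distribution \<Rightarrow> nat \<Rightarrow> complex" where
  "SN_coeff N \<phi> = (SOME a. \<phi> = train_comb N a)"

definition SN_inner :: "nat \<Rightarrow> distribution \<Rightarrow> distribution \<Rightarrow> complex" where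
  "SN_inner N \<phi> \<psi> = (\<Sum>n<N. SN_coeff N \<phi> n * cnj (SN_coeff N \<psi> n))"

end

theory Submission
  imports Defs "HOL-Probability.Characteristic_Functions"
begin

text \<open>The functional \<open>\<epsilon>\<^sub>n\<close> samples the continuous representative \<open>h\<close> of its argument on the coset
\<open>n/N + \<int>\<close>, so the short-time Fourier transform of a delta train is a trigonometric series in \<open>\<xi>\<close>,
\<open>\<Sum>k. exp (- 2 \<pi> \<i> \<xi> (n/N + k)) * cnj (h (n/N + k - x))\<close>.
All frequencies lie in \<open>(1/N) \<int>\<close>, and different pairs \<open>(n, k)\<close> give different frequencies. Integrating a
product of two such series over one period \<open>\<xi> \<in> [0, N]\<close> therefore leaves only the diagonal terms, each
with the factor \<open>N\<close>; integrating these over \<open>x \<in> [0, 1]\<close> and summing over \<open>k\<close> glues the unit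
intervals together to the whole line and produces \<open>\<langle>g2, g1\<rangle>\<close>. This is \<open>delta_train_orthogonality\<close>,
and the general formula is its sesquilinear extension, valid for any choice of coefficients.

Two analytic facts are behind the interchange of sums and integrals: every \<open>f\<close> in \<open>S0\<close> has a
continuous representative \<open>h\<close>, and \<open>\<Sum>k. \<bar>h (y + k)\<bar>\<close> is bounded uniformly in \<open>y\<close>. Both come from the
Gabor reconstruction formula (\<open>gabor_reconstruction\<close>), which says that \<open>f\<close> agrees almost everywhere
with a constant multiple of \<open>\<integral>\<integral> V(x, \<xi>) exp (2 \<pi> \<i> \<xi> t) gauss (t - x) dx d\<xi>\<close>, where \<open>V\<close> is the
integrable short-time Fourier transform of \<open>f\<close>. The right-hand side is continuous by dominated
convergence, and its lattice sums are bounded because those of the Gaussian are. The formula holds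
since \<open>V(x, \<cdot>)\<close> is the Fourier transform of \<open>t \<mapsto> f t * gauss (t - x)\<close>: Fourier inversion recovers
this function for almost every \<open>x\<close>, and integrating it against \<open>gauss (t - x)\<close> over \<open>x\<close> recovers \<open>f\<close>.

Fourier inversion for an integrable function with integrable transform (\<open>fourier_inversion\<close>) is
proved by Gaussian summation, comparing integrals over bounded intervals.\<close>

section \<open>Characters and integrability of products\<close>

definition wave :: "real \<Rightarrow> complex" where
  "wave y = cis (2 * pi * y)"

lemma wave_add: "wave (x + y) = wave x * wave y"
  by (simp add: wave_def cis_mult distrib_left)

lemma cnj_wave: "cnj (wave y) = wave (- y)"
  by (simp add: wave_def cis_cnj)

lemma norm_wave [simp]: "norm (wave y) = 1"
  by (simp add: wave_def)

lemma wave_0 [simp]: "wave 0 = 1"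
  by (simp add: wave_def)

lemma wave_of_int [simp]: "wave (of_int k) = 1"
  unfolding wave_def by (rule cis_multiple_2pi) simp

lemma continuous_on_wave [continuous_intros]:
  "continuous_on A f \<Longrightarrow> continuous_on A (\<lambda>x. wave (f x))"
  unfolding wave_def cis_conv_exp by (intro continuous_intros)

lemma borel_measurable_wave [measurable]: "wave \<in> borel_measurable borel"
  by (intro borel_measurable_continuous_onI continuous_intros)

lemma modulate_eq_wave: "modulate \<xi> f t = wave (\<xi> * t) * f t"
  by (simp add: modulate_def wave_def cis_conv_exp mult_ac)

lemma integrable_mult_bounded:
  fixes f g :: "'a \<Rightarrow> complex"
  assumes "integrable M f" "g \<in> borel_measurable M" "\<And>x. norm (g x) \<le> B"
  shows "integrable M (\<lambda>x. f x * g x)"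
proof (rule Bochner_Integration.integrable_bound)
  show "integrable M (\<lambda>x. B * norm (f x))"
    using assms(1) by simp
  show "AE x in M. norm (f x * g x) \<le> norm (B * norm (f x))"
  proof (rule AE_I2)
    fix x
    have "norm (f x) * norm (g x) \<le> norm (f x) * B"
      by (intro mult_left_mono assms(3)) simp
    then show "norm (f x * g x) \<le> norm (B * norm (f x))"
      by (simp add: norm_mult mult.commute)
  qed
qed (use assms in measurable)

lemma integrable_tensor:
  fixes f g :: "real \<Rightarrow> complex"
  assumes "integrable lborel f" "integrable lborel g"
  shows "integrable (lborel \<Otimes>\<^sub>M lborel) (\<lambda>(x, y). f x * g y)"
proof -
  note [measurable] = borel_measurable_integrable[OF assms(1)] borel_measurable_integrable[OF assms(2)]
  show ?thesis
    by (rule lborel_pair.Fubini_integrable)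
       (use assms in \<open>auto simp: norm_mult intro!: integrable_mult_left integrable_mult_right\<close>)
qed

lemma integrable_indicator_Icc:
  "integrable lborel (indicator {a..b::real} :: real \<Rightarrow> complex)"
proof -
  have "integrable lborel (\<lambda>t. of_real (indicator {a..b} t) :: complex)"
    by (intro integrable_of_real integrable_real_indicator) (auto simp: emeasure_lborel_Icc_eq)
  moreover have "(\<lambda>t. of_real (indicator {a..b} t)) = (indicator {a..b} :: real \<Rightarrow> complex)"
    by (auto simp: indicator_def)
  ultimately show ?thesis by simp
qed

section \<open>Fourier inversion\<close>

text \<open>The normal density is its own characteristic function up to normalisation. A change of variable
turns this into: the inverse transform of the summability factor
\<open>exp (- (2 \<pi> \<xi> / r)\<^sup>2 / 2)\<close>, which tends to \<open>1\<close> for large \<open>r\<close>, is the density of a normal variable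
with standard deviation \<open>1 / r\<close>.\<close>
lemma fourier_std_normal:
  fixes r \<tau> :: real
  assumes r: "r > 0"
  shows "integrable lborel (\<lambda>\<xi>. of_real (exp (- (2 * pi * \<xi> / r)\<^sup>2 / 2)) :: complex)"
    and "(LINT \<xi>|lborel. wave (\<xi> * \<tau>) * of_real (exp (- (2 * pi * \<xi> / r)\<^sup>2 / 2)))
       = of_real (r * std_normal_density (r * \<tau>))"
proof -
  let ?R = "\<lambda>\<xi>. exp (- (2 * pi * \<xi> / r)\<^sup>2 / 2)"
  let ?D = std_normal_density
  have R: "?R \<xi> = sqrt (2 * pi) * ?D (0 + (2 * pi / r) * \<xi>)" for \<xi>
    by (simp add: std_normal_density_def field_simps)
  have "integrable lborel (\<lambda>\<xi>. ?D (0 + (2 * pi / r) * \<xi>))"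
    by (rule lborel_integrable_real_affine) (use r in \<open>auto intro: integrable_normal_density\<close>)
  then show "integrable lborel (\<lambda>\<xi>. of_real (?R \<xi>) :: complex)"
    unfolding R by (intro integrable_of_real integrable_mult_right) 
  have "of_real (exp (- (r * \<tau>)\<^sup>2 / 2)) = char std_normal_distribution (r * \<tau>)"
    by (simp add: char_std_normal_distribution)
  also have "\<dots> = (LINT y|lborel. ?D y *\<^sub>R iexp (r * \<tau> * y))"
    unfolding char_def by (subst integral_density) (auto simp: normal_density_nonneg)
  also have "\<dots> = (2 * pi / r) *\<^sub>R (LINT \<xi>|lborel. ?D (0 + (2 * pi / r) * \<xi>) *\<^sub>R iexp (r * \<tau> * (0 + (2 * pi / r) * \<xi>)))"
    using r by (subst lborel_integral_real_affine[where c="2 * pi / r" and t=0]) auto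
  also have "(\<lambda>\<xi>. ?D (0 + (2 * pi / r) * \<xi>) *\<^sub>R iexp (r * \<tau> * (0 + (2 * pi / r) * \<xi>)))
     = (\<lambda>\<xi>. (wave (\<xi> * \<tau>) * of_real (?R \<xi>)) / of_real (sqrt (2 * pi)))"
    unfolding R using r by (auto simp: wave_def cis_conv_exp scaleR_conv_of_real field_simps)
  finally have "of_real (exp (- (r * \<tau>)\<^sup>2 / 2)) =
     (2 * pi / r) *\<^sub>R (LINT \<xi>|lborel. wave (\<xi> * \<tau>) * of_real (?R \<xi>)) / of_real (sqrt (2 * pi))"
    by (simp add: scaleR_conv_of_real)
  also have "\<dots> = of_real ((2 * pi / r) / sqrt (2 * pi)) * (LINT \<xi>|lborel. wave (\<xi> * \<tau>) * of_real (?R \<xi>))"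
    by (simp add: scaleR_conv_of_real)
  also have "(2 * pi / r) / sqrt (2 * pi) = ((2 * pi) / sqrt (2 * pi)) / r"
    by simp
  also have "(2 * pi) / sqrt (2 * pi) = sqrt (2 * pi)"
    by (rule real_div_sqrt) simp
  finally have *: "of_real (sqrt (2 * pi)) * (LINT \<xi>|lborel. wave (\<xi> * \<tau>) * of_real (?R \<xi>))
      = of_real (r * exp (- (r * \<tau>)\<^sup>2 / 2))"
    using r by simp
  have "of_real (sqrt (2 * pi)) * (LINT \<xi>|lborel. wave (\<xi> * \<tau>) * of_real (?R \<xi>))
      = of_real (sqrt (2 * pi)) * (of_real (r * ?D (r * \<tau>)) :: complex)"
    unfolding * by (simp add: std_normal_density_def)
  then show "(LINT \<xi>|lborel. wave (\<xi> * \<tau>) * of_real (?R \<xi>)) = of_real (r * ?D (r * \<tau>))"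
    by (subst (asm) mult_cancel_left) simp
qed

text \<open>The class of Borel sets over which a fixed truncation of \<open>w\<close> integrates to zero is a Dynkin system
containing all half-lines, hence contains all Borel sets. The truncation is needed because \<open>w\<close> is
only locally integrable.\<close>
lemma AE_zero_if_interval_integrals_zero:
  fixes w :: "real \<Rightarrow> complex"
  assumes int: "\<And>a b. set_integrable lborel {a..b} w"
    and zero: "\<And>a b. (LINT t:{a..b}|lborel. w t) = 0"
  shows "AE t in lborel. w t = 0"
proof -
  have "AE t in lborel. \<forall>n::nat. indicator {-real n..real n} t *\<^sub>R w t = 0"
  proof (subst AE_all_countable, rule allI)
    fix n :: nat
    let ?f = "\<lambda>t. indicator {-real n..real n} t *\<^sub>R w t"
    have f: "integrable lborel ?f"
      using int[of "-real n" "real n"] by (simp add: set_integrable_def)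
    note [measurable] = borel_measurable_integrable[OF f]
    show "AE t in lborel. ?f t = 0"
    proof (rule sigma_finite_measure.density_zero[OF _ f])
      fix A :: "real set" assume "A \<in> sets lborel"
      then have A: "A \<in> sigma_sets UNIV (range (\<lambda>a::real. {..a}))"
        by (simp add: borel_eq_atMost)
      have eq: "sigma_sets UNIV (range (\<lambda>a::real. {..a})) = sets borel"
        by (simp add: borel_eq_atMost)
      have setint: "set_integrable lborel B ?f" if "B \<in> sets borel" for B
        unfolding set_integrable_def by (rule integrable_mult_indicator[OF _ f]) (use that in simp)
      have total: "(LINT t|lborel. ?f t) = 0"
        using zero[of "-real n" "real n"] by (simp add: set_lebesgue_integral_def)
      have "Int_stable (range (\<lambda>a::real. {..a}))" "range (\<lambda>a::real. {..a}) \<subseteq> Pow UNIV"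
        by (auto simp: Int_stable_def)
      from this A show "(LINT t:A|lborel. ?f t) = 0"
      proof (induction rule: sigma_sets_induct_disjoint)
        case (basic B)
        then obtain a where B: "B = {..a}" by auto
        have "(LINT t:B|lborel. ?f t) = (LINT t:{-real n..min a (real n)}|lborel. w t)"
          unfolding set_lebesgue_integral_def B
          by (rule Bochner_Integration.integral_cong) (auto simp: indicator_def)
        then show ?case by (simp add: zero)
      next
        case (compl B)
        then have B: "B \<in> sets borel" by (simp add: eq)
        have "(LINT t:(UNIV - B)|lborel. ?f t) = (LINT t|lborel. ?f t - indicator B t *\<^sub>R ?f t)"
          unfolding set_lebesgue_integral_def
          by (rule Bochner_Integration.integral_cong) (auto simp: indicator_def)
        also have "\<dots> = (LINT t|lborel. ?f t) - (LINT t:B|lborel. ?f t)"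
          using setint[OF B] f unfolding set_lebesgue_integral_def set_integrable_def
          by (rule Bochner_Integration.integral_diff[rotated])
        finally show ?case using compl total by simp
      next
        case (union B)
        then have B: "\<And>i. B i \<in> sets borel" by (auto simp: eq)
        show ?case
          by (subst lebesgue_integral_countable_add)
             (use B union in \<open>auto simp: disjoint_family_on_def intro!: setint\<close>)
      qed (auto simp: set_lebesgue_integral_def)
    qed unfold_locales
  qed
  then show ?thesis
  proof eventually_elim
    case (elim t)
    obtain n :: nat where "\<bar>t\<bar> \<le> real n" using real_arch_simple by blast
    then show ?case using elim[rule_format, of n] by (auto simp: indicator_def split: if_splits)
  qed
qed

lemma std_normal_mass_of_dilated_interval:
  fixes a b s r :: real
  assumes "r > 0"
  shows "(LINT t|lborel. indicator {a..b} t * (r * std_normal_density (r * (t - s))))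
       = (LINT y|lborel. indicator {a..b} (s + y / r) * std_normal_density y)"
proof -
  have "(LINT y|lborel. indicator {a..b} (s + y / r) * std_normal_density y)
      = r * (LINT t|lborel. indicator {a..b} (s + (- r * s + r * t) / r) * std_normal_density (- r * s + r * t))"
    using assms by (subst lborel_integral_real_affine[where c=r and t="- r * s"]) auto
  also have "\<dots> = (LINT t|lborel. r * (indicator {a..b} (s + (- r * s + r * t) / r) * std_normal_density (- r * s + r * t)))"
    by simp
  also have "\<dots> = (LINT t|lborel. indicator {a..b} t * (r * std_normal_density (r * (t - s))))"
    using assms by (intro Bochner_Integration.integral_cong) (auto simp: field_simps)
  finally show ?thesis by simp
qed

lemma std_normal_mass_bounds:
  assumes [measurable]: "A \<in> sets borel"
  shows "0 \<le> (LINT y|lborel. indicator A (s + y / r) * std_normal_density y)"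
    and "(LINT y|lborel. indicator A (s + y / r) * std_normal_density y) \<le> 1"
proof -
  let ?I = "\<lambda>y. indicator A (s + y / r) * std_normal_density y"
  show "0 \<le> (LINT y|lborel. ?I y)"
    by (intro Bochner_Integration.integral_nonneg) (auto simp: indicator_def)
  have "(LINT y|lborel. ?I y) \<le> (LINT y|lborel. std_normal_density y)"
  proof (rule integral_mono)
    show "integrable lborel ?I"
      by (rule Bochner_Integration.integrable_bound[of _ std_normal_density])
         (auto simp: indicator_def)
  qed (auto simp: indicator_def)
  then show "(LINT y|lborel. ?I y) \<le> 1"
    by (simp add: integral_normal_density)
qed

text \<open>At the endpoints \<open>a\<close> and \<open>b\<close> the limit of the mass is \<open>1/2\<close> when \<open>a < b\<close>; away from them the
indicator is continuous at \<open>s\<close>.\<close>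
lemma std_normal_mass_tendsto_indicator:
  assumes "s \<noteq> a" "s \<noteq> b"
  shows "(\<lambda>n. LINT y|lborel. indicator {a..b} (s + y / real (Suc n)) * std_normal_density y)
    \<longlonglongrightarrow> indicator {a..b} s"
proof -
  have "(\<lambda>n. LINT y|lborel. indicator {a..b} (s + y / real (Suc n)) * std_normal_density y)
    \<longlonglongrightarrow> (LINT y|lborel. indicator {a..b} s * std_normal_density y)"
  proof (rule integral_dominated_convergence[where w=std_normal_density])
    show "AE y in lborel. (\<lambda>n. indicator {a..b} (s + y / real (Suc n)) * std_normal_density y)
        \<longlonglongrightarrow> indicator {a..b} s * std_normal_density y"
    proof (intro AE_I2 tendsto_mult_right)
      fix y :: real
      have lim: "(\<lambda>n. s + y / real (Suc n)) \<longlonglongrightarrow> s"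
        using LIMSEQ_inverse_real_of_nat[THEN tendsto_mult_right, of y, THEN tendsto_add[OF tendsto_const], of s]
        by (simp add: divide_inverse mult.commute)
      have "isCont (indicat_real {a..b}) s"
        using assms by (simp add: isCont_indicator frontier_def interior_atLeastAtMost_real)
      then show "(\<lambda>n. indicat_real {a..b} (s + y / real (Suc n))) \<longlonglongrightarrow> indicator {a..b} s"
        using lim by (rule isCont_tendsto_compose)
    qed
  qed (auto simp: indicator_def)
  then show ?thesis by (simp add: integral_normal_density)
qed

text \<open>The inserted Gaussian makes the double integral over \<open>s\<close> and \<open>\<xi>\<close> absolutely convergent, so that
Fubini's theorem turns the damped inverse transform into a convolution of \<open>u\<close> with a narrow normal
density.\<close>
lemma gaussian_mean_of_fourier:
  fixes u :: "real \<Rightarrow> complex"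
  assumes u: "integrable lborel u" and r: "r > 0"
  defines "U \<equiv> \<lambda>\<xi>. LINT s|lborel. u s * wave (- (\<xi> * s))"
  shows "(LINT \<xi>|lborel. U \<xi> * wave (\<xi> * t) * of_real (exp (- (2 * pi * \<xi> / r)\<^sup>2 / 2)))
       = (LINT s|lborel. u s * of_real (r * std_normal_density (r * (t - s))))"
proof -
  let ?R = "\<lambda>\<xi>. of_real (exp (- (2 * pi * \<xi> / r)\<^sup>2 / 2)) :: complex"
  note [measurable] = borel_measurable_integrable[OF u]
  have "integrable (lborel \<Otimes>\<^sub>M lborel) (\<lambda>p. (case p of (s, \<xi>) \<Rightarrow> u s * ?R \<xi>) * wave (snd p * (t - fst p)))"
    by (rule integrable_mult_bounded[where B=1])
       (use integrable_tensor[OF u fourier_std_normal(1)[OF r]] in auto)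
  then have int: "integrable (lborel \<Otimes>\<^sub>M lborel) (\<lambda>(s, \<xi>). u s * ?R \<xi> * wave (\<xi> * (t - s)))"
    by (simp add: case_prod_unfold)
  have "(LINT \<xi>|lborel. U \<xi> * wave (\<xi> * t) * ?R \<xi>)
      = (LINT \<xi>|lborel. LINT s|lborel. u s * ?R \<xi> * wave (\<xi> * (t - s)))"
  proof (rule Bochner_Integration.integral_cong)
    fix \<xi>
    have "U \<xi> * wave (\<xi> * t) * ?R \<xi> = (LINT s|lborel. (u s * wave (- (\<xi> * s))) * (wave (\<xi> * t) * ?R \<xi>))"
      unfolding U_def by (simp only: mult.assoc[of "integral\<^sup>L _ _"] integral_mult_left_zero)
    also have "\<dots> = (LINT s|lborel. u s * ?R \<xi> * wave (\<xi> * (t - s)))"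
    proof (intro Bochner_Integration.integral_cong refl)
      fix s
      have "wave (\<xi> * (t - s)) = wave (- (\<xi> * s)) * wave (\<xi> * t)"
        unfolding wave_add[symmetric] by (simp add: right_diff_distrib)
      then show "(u s * wave (- (\<xi> * s))) * (wave (\<xi> * t) * ?R \<xi>) = u s * ?R \<xi> * wave (\<xi> * (t - s))"
        by (simp only: mult_ac)
    qed
    finally show "U \<xi> * wave (\<xi> * t) * ?R \<xi> = (LINT s|lborel. u s * ?R \<xi> * wave (\<xi> * (t - s)))" .
  qed simp
  also have "\<dots> = (LINT s|lborel. LINT \<xi>|lborel. u s * ?R \<xi> * wave (\<xi> * (t - s)))"
    using lborel_pair.Fubini_integral[OF int] .
  also have "\<dots> = (LINT s|lborel. u s * of_real (r * std_normal_density (r * (t - s))))"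
  proof (intro Bochner_Integration.integral_cong refl)
    fix s
    have "(\<lambda>\<xi>. u s * ?R \<xi> * wave (\<xi> * (t - s))) = (\<lambda>\<xi>. u s * (wave (\<xi> * (t - s)) * ?R \<xi>))"
      by (simp only: mult_ac)
    then show "(LINT \<xi>|lborel. u s * ?R \<xi> * wave (\<xi> * (t - s))) = u s * of_real (r * std_normal_density (r * (t - s)))"
      by (simp only: integral_mult_right_zero fourier_std_normal(2)[OF r])
  qed
  finally show ?thesis .
qed

text \<open>Let \<open>v\<close> be the inverse transform of \<open>U\<close>. The Gaussian means \<open>W n\<close> converge pointwise and boundedly to
\<open>v\<close>, because \<open>U\<close> is integrable. Their integrals over \<open>[a, b]\<close> are integrals of \<open>u\<close> against the mass
that narrow normal densities centred at \<open>s\<close> give to \<open>[a, b]\<close>, and this mass tends to the indicator of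
\<open>[a, b]\<close>. So \<open>u\<close> and \<open>v\<close> have the same integrals over all intervals. Testing on intervals avoids the
pointwise or \<open>L\<^sup>1\<close> convergence of approximate identities.\<close>
theorem fourier_inversion:
  fixes u :: "real \<Rightarrow> complex"
  assumes u: "integrable lborel u"
  defines "U \<equiv> \<lambda>\<xi>. LINT s|lborel. u s * wave (- (\<xi> * s))"
  assumes U: "integrable lborel U"
  shows "AE t in lborel. u t = (LINT \<xi>|lborel. U \<xi> * wave (\<xi> * t))"
proof -
  define v where "v t = (LINT \<xi>|lborel. U \<xi> * wave (\<xi> * t))" for t
  define r :: "nat \<Rightarrow> real" where "r n = real (Suc n)" for n
  have r: "r n > 0" for n by (simp add: r_def)
  let ?R = "\<lambda>n \<xi>. of_real (exp (- (2 * pi * \<xi> / r n)\<^sup>2 / 2)) :: complex"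
  let ?P = "\<lambda>a b s n. LINT y|lborel. indicator {a..b} (s + y / r n) * std_normal_density y"
  define W where "W n t = (LINT \<xi>|lborel. U \<xi> * wave (\<xi> * t) * ?R n \<xi>)" for n t
  note [measurable] = borel_measurable_integrable[OF u] borel_measurable_integrable[OF U]
  have v_meas [measurable]: "v \<in> borel_measurable borel"
    unfolding v_def by measurable
  have W_meas [measurable]: "W n \<in> borel_measurable borel" for n
    unfolding W_def by measurable
  have v_bound: "norm (v t) \<le> (LINT \<xi>|lborel. norm (U \<xi>))" for t
    unfolding v_def by (rule order_trans[OF integral_norm_bound]) (simp add: norm_mult)
  have W_bound: "norm (W n t) \<le> (LINT \<xi>|lborel. norm (U \<xi>))" for n t
    unfolding W_def
  proof (rule order_trans[OF integral_norm_bound], rule integral_mono)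
    have "integrable lborel (\<lambda>\<xi>. U \<xi> * (wave (\<xi> * t) * ?R n \<xi>))"
      by (rule integrable_mult_bounded[OF U, where B=1]) (auto simp: norm_mult)
    then show "integrable lborel (\<lambda>\<xi>. norm (U \<xi> * wave (\<xi> * t) * ?R n \<xi>))"
      by (simp add: mult.assoc)
  qed (use U in \<open>auto simp: norm_mult mult_left_le\<close>)
  have W_lim: "(\<lambda>n. W n t) \<longlonglongrightarrow> v t" for t
    unfolding W_def v_def
  proof (rule integral_dominated_convergence[where w="\<lambda>\<xi>. norm (U \<xi>)"])
    show "AE \<xi> in lborel. (\<lambda>n. U \<xi> * wave (\<xi> * t) * ?R n \<xi>) \<longlonglongrightarrow> U \<xi> * wave (\<xi> * t)"
    proof (rule AE_I2)
      fix \<xi> :: real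
      have "(\<lambda>n. exp (- (2 * pi * \<xi> / r n)\<^sup>2 / 2)) \<longlonglongrightarrow> 1"
      proof -
        have "(\<lambda>n. inverse (r n)) \<longlonglongrightarrow> 0"
          unfolding r_def by (rule LIMSEQ_inverse_real_of_nat)
        then have "(\<lambda>n. exp (- (2 * pi * \<xi> * inverse (r n))\<^sup>2 / 2)) \<longlonglongrightarrow> exp (- (2 * pi * \<xi> * 0)\<^sup>2 / 2)"
          by (intro tendsto_exp tendsto_divide tendsto_minus tendsto_power tendsto_mult tendsto_const) auto
        then show ?thesis by (simp only: divide_inverse mult_zero_right exp_zero mult_zero_left power_zero_numeral minus_zero)
      qed
      then have "(\<lambda>n. ?R n \<xi>) \<longlonglongrightarrow> of_real 1"
        by (rule tendsto_of_real)
      from tendsto_mult[OF tendsto_const this, of "U \<xi> * wave (\<xi> * t)"]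
      show "(\<lambda>n. U \<xi> * wave (\<xi> * t) * ?R n \<xi>) \<longlonglongrightarrow> U \<xi> * wave (\<xi> * t)"
        by simp
    qed
  qed (use U in \<open>auto simp: norm_mult mult_left_le\<close>)
  have set_int: "set_integrable lborel {a..b} f"
    if "f \<in> borel_measurable borel" "\<And>t. norm (f t) \<le> B" for f :: "real \<Rightarrow> complex" and a b B
  proof -
    have "integrable lborel (\<lambda>t. (indicator {a..b} t :: complex) * f t)"
      by (rule integrable_mult_bounded[OF integrable_indicator_Icc]) (use that in auto)
    then show ?thesis by (simp add: set_integrable_def indicator_scaleR_eq_if indicator_times_eq_if)
  qed
  have eq: "(LINT t:{a..b}|lborel. W n t) = (LINT s|lborel. u s * of_real (?P a b s n))" for a b n
  proof -
    \<comment> \<open>The narrow normal density is bounded by \<open>r n\<close>, which justifies the change of order of integration.\<close>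
    have "integrable (lborel \<Otimes>\<^sub>M lborel) (\<lambda>p. (case p of (s, t) \<Rightarrow> u s * (indicator {a..b} t :: complex))
             * of_real (r n * std_normal_density (r n * (snd p - fst p))))"
    proof (rule integrable_mult_bounded[where B="r n * 1"])
      fix p :: "real \<times> real"
      have "std_normal_density y \<le> 1" for y
      proof -
        have "1 \<le> sqrt (2 * pi)" using pi_ge_two by simp
        then show ?thesis
          unfolding std_normal_density_def by (intro mult_le_one) auto
      qed
      then show "norm (of_real (r n * std_normal_density (r n * (snd p - fst p))) :: complex) \<le> r n * 1"
        unfolding norm_of_real using r[of n] by (auto simp: abs_mult intro!: mult_left_mono)
    qed (use integrable_tensor[OF u integrable_indicator_Icc] in auto)
    then have int: "integrable (lborel \<Otimes>\<^sub>M lborel)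
        (\<lambda>(s, t). u s * (indicator {a..b} t * of_real (r n * std_normal_density (r n * (t - s)))))"
      by (simp add: case_prod_unfold mult.assoc)
    have "(LINT t:{a..b}|lborel. W n t) = (LINT t|lborel. LINT s|lborel.
            u s * (indicator {a..b} t * of_real (r n * std_normal_density (r n * (t - s)))))"
      unfolding set_lebesgue_integral_def W_def U_def gaussian_mean_of_fourier[OF u r]
      by (intro Bochner_Integration.integral_cong refl) (auto simp: indicator_def)
    also have "\<dots> = (LINT s|lborel. LINT t|lborel.
            u s * (indicator {a..b} t * of_real (r n * std_normal_density (r n * (t - s)))))"
      by (rule lborel_pair.Fubini_integral[OF int])
    also have "\<dots> = (LINT s|lborel. u s * of_real (?P a b s n))"
    proof (intro Bochner_Integration.integral_cong refl)
      fix s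
      have "indicator {a..b} t * of_real (r n * std_normal_density (r n * (t - s)))
          = (of_real (indicator {a..b} t * (r n * std_normal_density (r n * (t - s)))) :: complex)" for t
        by (auto simp: indicator_def)
      then show "(LINT t|lborel. u s * (indicator {a..b} t * of_real (r n * std_normal_density (r n * (t - s)))))
          = u s * of_real (?P a b s n)"
        by (simp only: integral_mult_right_zero integral_complex_of_real std_normal_mass_of_dilated_interval[OF r])
    qed
    finally show ?thesis .
  qed
  have eq_uv: "(LINT t:{a..b}|lborel. u t) = (LINT t:{a..b}|lborel. v t)" for a b
  proof (rule LIMSEQ_unique)
    show "(\<lambda>n. LINT t:{a..b}|lborel. W n t) \<longlonglongrightarrow> (LINT t:{a..b}|lborel. v t)"
      unfolding set_lebesgue_integral_def
    proof (rule integral_dominated_convergence[where w="\<lambda>t. indicator {a..b} t * (LINT \<xi>|lborel. norm (U \<xi>))"])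
      show "AE t in lborel. norm (indicator {a..b} t *\<^sub>R W n t) \<le> indicator {a..b} t * (LINT \<xi>|lborel. norm (U \<xi>))" for n
        using W_bound by (auto simp: indicator_def)
    qed (use W_lim in \<open>auto intro!: tendsto_scaleR integrable_mult_left integrable_real_indicator
           simp: emeasure_lborel_Icc_eq\<close>)
    have AE: "AE s in lborel. s \<noteq> a \<and> s \<noteq> b"
      using AE_lborel_singleton[of a] AE_lborel_singleton[of b] by eventually_elim auto
    have "(\<lambda>n. LINT s|lborel. u s * of_real (?P a b s n)) \<longlonglongrightarrow> (LINT s|lborel. u s * of_real (indicator {a..b} s))"
    proof (rule integral_dominated_convergence[where w="\<lambda>s. norm (u s)"])
      show "AE s in lborel. (\<lambda>n. u s * of_real (?P a b s n)) \<longlonglongrightarrow> u s * of_real (indicator {a..b} s)"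
        using AE by eventually_elim
          (auto simp: r_def simp del: of_nat_Suc intro!: tendsto_intros std_normal_mass_tendsto_indicator)
      show "AE s in lborel. norm (u s * of_real (?P a b s n)) \<le> norm (u s)" for n
        using std_normal_mass_bounds[of "{a..b}" _ "r n"]
        by (auto simp: norm_mult intro!: mult_left_le)
    qed (use u in auto)
    also have "(\<lambda>s. u s * of_real (indicator {a..b} s)) = (\<lambda>s. indicator {a..b} s *\<^sub>R u s)"
      by (auto simp: scaleR_conv_of_real)
    finally show "(\<lambda>n. LINT t:{a..b}|lborel. W n t) \<longlonglongrightarrow> (LINT t:{a..b}|lborel. u t)"
      unfolding eq unfolding set_lebesgue_integral_def .
  qed
  have u_int: "set_integrable lborel {a..b} u" for a b
    unfolding set_integrable_def using u by (intro integrable_mult_indicator) auto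
  have v_int: "set_integrable lborel {a..b} v" for a b
    using v_meas v_bound by (rule set_int)
  have "AE t in lborel. u t - v t = 0"
    by (rule AE_zero_if_interval_integrals_zero)
       (simp_all add: set_integral_diff(1)[OF u_int v_int] set_integral_diff(2)[OF u_int v_int] eq_uv)
  then show ?thesis by (simp add: v_def)
qed

section \<open>The Gaussian window\<close>

lemma continuous_on_gauss [continuous_intros]:
  "continuous_on A f \<Longrightarrow> continuous_on A (\<lambda>x. gauss (f x))"
  unfolding gauss_def by (intro continuous_intros)

lemma borel_measurable_gauss [measurable]: "gauss \<in> borel_measurable borel"
  by (intro borel_measurable_continuous_onI continuous_intros)

lemma norm_gauss: "norm (gauss t) = exp (- pi * t\<^sup>2)"
  by (simp add: gauss_def)

lemma norm_gauss_le_1: "norm (gauss t) \<le> 1"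
  by (simp add: norm_gauss)

lemma cnj_gauss [simp]: "cnj (gauss t) = gauss t"
  by (simp add: gauss_def)

lemma integrable_exp_neg_square:
  assumes "c > 0"
  shows "integrable lborel (\<lambda>t::real. exp (- c * t\<^sup>2))"
proof -
  define \<sigma> where "\<sigma> = 1 / sqrt (2 * c)"
  have \<sigma>: "\<sigma> > 0" "\<sigma>\<^sup>2 = 1 / (2 * c)"
    using assms by (simp_all add: \<sigma>_def power_divide)
  have "exp (- c * t\<^sup>2) = sqrt (2 * pi * \<sigma>\<^sup>2) * normal_density 0 \<sigma> t" for t
    using \<sigma> assms by (simp add: normal_density_def field_simps)
  then show ?thesis
    using \<sigma> by (simp add: integrable_normal_density)
qed

lemma gauss_L2: "gauss \<in> L2"
proof -
  have "(\<lambda>t. (norm (gauss t))\<^sup>2) = (\<lambda>t. exp (- (2 * pi) * t\<^sup>2))"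
    by (auto simp: norm_gauss simp flip: exp_double)
  then show ?thesis
    using integrable_exp_neg_square[of "2 * pi"] by (simp add: L2_def)
qed

lemma L2_mult_integrable:
  assumes "f \<in> L2" "g \<in> L2"
  shows "integrable lborel (\<lambda>t. f t * g t)"
proof (rule Bochner_Integration.integrable_bound)
  show "integrable lborel (\<lambda>t. (norm (f t))\<^sup>2 + (norm (g t))\<^sup>2)"
    using assms by (auto simp: L2_def)
  show "(\<lambda>t. f t * g t) \<in> borel_measurable lborel"
    using assms by (auto simp: L2_def)
  have "a * b \<le> a\<^sup>2 + b\<^sup>2" if "a \<ge> 0" "b \<ge> 0" for a b :: real
    using sum_squares_bound[of a b] that mult_nonneg_nonneg[OF that] by linarith
  then show "AE t in lborel. norm (f t * g t) \<le> norm ((norm (f t))\<^sup>2 + (norm (g t))\<^sup>2)"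
    by (intro AE_I2) (simp add: norm_mult)
qed

lemma L2_translate:
  assumes "f \<in> L2"
  shows "translate x f \<in> L2"
proof -
  have [measurable]: "f \<in> borel_measurable borel" using assms by (simp add: L2_def)
  have "integrable lborel (\<lambda>t. (norm (f (- x + 1 * t)))\<^sup>2)"
    by (rule lborel_integrable_real_affine) (use assms in \<open>auto simp: L2_def\<close>)
  then show ?thesis
    by (simp add: L2_def translate_def[abs_def])
qed

lemma L2_tf_shift:
  assumes "f \<in> L2"
  shows "tf_shift x \<xi> f \<in> L2"
proof -
  have [measurable]: "translate x f \<in> borel_measurable borel"
    and "integrable lborel (\<lambda>t. (norm (translate x f t))\<^sup>2)"
    using L2_translate[OF assms, of x] by (simp_all add: L2_def)
  then show ?thesis
    by (simp add: L2_def tf_shift_def modulate_eq_wave[abs_def] norm_mult)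
qed

lemma sum_geometric_int_le:
  fixes r :: real
  assumes r: "0 \<le> r" "r < 1" and "finite J"
  shows "(\<Sum>j\<in>J. r ^ nat \<bar>j::int\<bar>) \<le> 2 / (1 - r)"
proof -
  have half: "(\<Sum>j\<in>A. r ^ nat \<bar>j::int\<bar>) \<le> 1 / (1 - r)"
    if "finite A" "inj_on (\<lambda>j. nat \<bar>j\<bar>) A" for A
  proof -
    have "(\<Sum>j\<in>A. r ^ nat \<bar>j\<bar>) = (\<Sum>i\<in>(\<lambda>j. nat \<bar>j\<bar>) ` A. r ^ i)"
      using that(2) by (simp add: sum.reindex)
    also have "\<dots> \<le> (\<Sum>i. r ^ i)"
      using r that(1) by (intro sum_le_suminf summable_geometric) auto
    also have "\<dots> = 1 / (1 - r)"
      using r by (intro suminf_geometric) simp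
    finally show ?thesis .
  qed
  have "(\<Sum>j\<in>J. r ^ nat \<bar>j\<bar>) = (\<Sum>j\<in>J \<inter> {0..}. r ^ nat \<bar>j\<bar>) + (\<Sum>j\<in>J \<inter> {..<0}. r ^ nat \<bar>j\<bar>)"
    using assms(3) by (subst sum.union_disjoint[symmetric]) (auto intro!: sum.cong)
  also have "\<dots> \<le> 1 / (1 - r) + 1 / (1 - r)"
    using assms(3) by (intro add_mono half) (auto simp: inj_on_def)
  finally show ?thesis by simp
qed

text \<open>Since \<open>\<pi> s\<^sup>2 \<ge> \<bar>s\<bar> - 1\<close>, the Gaussian is dominated by a two-sided exponential; shifting the summation
index by \<open>\<lfloor>z\<rfloor>\<close> makes the resulting geometric bound independent of \<open>z\<close>.\<close>
lemma gauss_lattice_sum_bounded: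
  obtains C where "\<And>z (K :: int set). finite K \<Longrightarrow> (\<Sum>k\<in>K. norm (gauss (z + of_int k))) \<le> C"
proof
  fix z :: real and K :: "int set" assume K: "finite K"
  have bound: "norm (gauss (z + of_int k)) \<le> exp 2 * exp (-1) ^ nat \<bar>k + \<lfloor>z\<rfloor>\<bar>" for k
  proof -
    let ?s = "z + of_int k"
    have "\<bar>?s\<bar> - 1 \<le> ?s\<^sup>2"
    proof -
      have "0 \<le> (\<bar>?s\<bar> - 1)\<^sup>2" by simp
      then have "2 * \<bar>?s\<bar> - 1 \<le> ?s\<^sup>2" by (simp add: power2_diff)
      then show ?thesis using abs_ge_zero[of ?s] by argo
    qed
    also have "\<dots> \<le> pi * ?s\<^sup>2"
      using mult_right_mono[of 1 pi "?s\<^sup>2"] pi_ge_two by simp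
    finally have "- pi * ?s\<^sup>2 \<le> 1 - \<bar>?s\<bar>" by simp
    moreover have "of_int \<bar>k + \<lfloor>z\<rfloor>\<bar> - 1 \<le> \<bar>?s\<bar>"
    proof -
      have "\<bar>of_int (k + \<lfloor>z\<rfloor>) - ?s\<bar> \<le> 1"
        using floor_correct[of z] by (simp add: abs_le_iff; linarith)
      then show ?thesis unfolding of_int_abs by linarith
    qed
    ultimately have "- pi * ?s\<^sup>2 \<le> 2 - real (nat \<bar>k + \<lfloor>z\<rfloor>\<bar>)" by simp
    then have "norm (gauss ?s) \<le> exp (2 - real (nat \<bar>k + \<lfloor>z\<rfloor>\<bar>))"
      unfolding norm_gauss by simp
    also have "\<dots> = exp 2 * exp (-1) ^ nat \<bar>k + \<lfloor>z\<rfloor>\<bar>"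
      by (simp add: exp_diff exp_minus divide_inverse power_inverse flip: exp_of_nat_mult)
    finally show ?thesis .
  qed
  have "(\<Sum>k\<in>K. norm (gauss (z + of_int k))) \<le> (\<Sum>k\<in>K. exp 2 * exp (-1) ^ nat \<bar>k + \<lfloor>z\<rfloor>\<bar>)"
    by (intro sum_mono bound)
  also have "\<dots> = exp 2 * (\<Sum>j\<in>(\<lambda>k. k + \<lfloor>z\<rfloor>) ` K. exp (-1) ^ nat \<bar>j\<bar>)"
    by (subst sum.reindex) (auto simp: sum_distrib_left)
  also have "\<dots> \<le> exp 2 * (2 / (1 - exp (-1)))"
    using K by (intro mult_left_mono sum_geometric_int_le) auto
  finally show "(\<Sum>k\<in>K. norm (gauss (z + of_int k))) \<le> exp 2 * (2 / (1 - exp (-1)))" .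
qed

section \<open>Gabor reconstruction and continuous representatives\<close>

text \<open>The superposition of the time-frequency shifts of the Gaussian with weights \<open>F\<close>, i.e. the adjoint of
the short-time Fourier transform.\<close>
definition gabor_synthesis :: "(real \<times> real \<Rightarrow> complex) \<Rightarrow> real \<Rightarrow> complex" where
  "gabor_synthesis F t = (LINT p|lborel. F p * (wave (snd p * t) * gauss (t - fst p)))"

lemma gabor_synthesis_integrable:
  assumes "integrable lborel F"
  shows "integrable lborel (\<lambda>p. F p * (wave (snd p * t) * gauss (t - fst p)))"
  by (rule integrable_mult_bounded[OF assms, where B=1])
     (auto simp: norm_mult norm_gauss_le_1 intro!: borel_measurable_continuous_onI continuous_intros)

lemma continuous_on_gabor_synthesis:
  assumes F: "integrable lborel F"
  shows "continuous_on UNIV (gabor_synthesis F)"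
proof (unfold continuous_on_sequentially, intro allI ballI impI)
  fix x :: "nat \<Rightarrow> real" and a assume "(\<forall>n. x n \<in> UNIV) \<and> x \<longlonglongrightarrow> a"
  then have x: "x \<longlonglongrightarrow> a" by simp
  show "(gabor_synthesis F \<circ> x) \<longlonglongrightarrow> gabor_synthesis F a"
    unfolding gabor_synthesis_def comp_def
  proof (rule integral_dominated_convergence[where w="\<lambda>p. norm (F p)"])
    show "AE p in lborel. (\<lambda>n. F p * (wave (snd p * x n) * gauss (x n - fst p)))
        \<longlonglongrightarrow> F p * (wave (snd p * a) * gauss (a - fst p))"
    proof (intro AE_I2 tendsto_mult_left)
      fix p :: "real \<times> real"
      have "continuous_on UNIV (\<lambda>t. wave (snd p * t) * gauss (t - fst p))"
        by (intro continuous_intros)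
      then show "(\<lambda>n. wave (snd p * x n) * gauss (x n - fst p)) \<longlonglongrightarrow> wave (snd p * a) * gauss (a - fst p)"
        using x by (rule continuous_on_tendsto_compose) auto
    qed
  qed (use F gabor_synthesis_integrable[OF F, THEN borel_measurable_integrable] in
        \<open>auto simp: norm_mult norm_gauss_le_1 intro!: mult_left_le\<close>)
qed

text \<open>The lattice sums of the Gaussian are bounded uniformly in the translation, so that those of any
absolutely convergent superposition of its time-frequency shifts are bounded by the same constant
times the integral of the weights.\<close>
lemma gabor_synthesis_lattice_sum_bounded:
  assumes F: "integrable lborel F"
  obtains C where "\<And>y (K :: int set). finite K \<Longrightarrow> (\<Sum>k\<in>K. norm (gabor_synthesis F (y + of_int k))) \<le> C"
proof -
  obtain C where C: "\<And>z (K :: int set). finite K \<Longrightarrow> (\<Sum>k\<in>K. norm (gauss (z + of_int k))) \<le> C"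
    using gauss_lattice_sum_bounded by blast
  show thesis
  proof
    fix y and K :: "int set" assume K: "finite K"
    let ?g = "\<lambda>k p. F p * (wave (snd p * (y + of_int k)) * gauss (y + of_int k - fst p))"
    have "(\<Sum>k\<in>K. norm (gabor_synthesis F (y + of_int k))) \<le> (\<Sum>k\<in>K. (LINT p|lborel. norm (?g k p)))"
      unfolding gabor_synthesis_def by (intro sum_mono integral_norm_bound)
    also have "\<dots> = (LINT p|lborel. (\<Sum>k\<in>K. norm (?g k p)))"
      by (intro Bochner_Integration.integral_sum[symmetric] integrable_norm gabor_synthesis_integrable F)
    also have "\<dots> \<le> (LINT p|lborel. norm (F p) * C)"
    proof (rule integral_mono)
      show "integrable lborel (\<lambda>p. \<Sum>k\<in>K. norm (?g k p))"
        by (intro Bochner_Integration.integrable_sum integrable_norm gabor_synthesis_integrable F)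
      show "integrable lborel (\<lambda>p. norm (F p) * C)"
        using F by simp
      fix p
      have "(\<Sum>k\<in>K. norm (?g k p)) = norm (F p) * (\<Sum>k\<in>K. norm (gauss ((y - fst p) + of_int k)))"
        by (simp add: norm_mult sum_distrib_left algebra_simps)
      also have "\<dots> \<le> norm (F p) * C"
        using C[OF K] by (intro mult_left_mono) auto
      finally show "(\<Sum>k\<in>K. norm (?g k p)) \<le> norm (F p) * C" .
    qed
    finally show "(\<Sum>k\<in>K. norm (gabor_synthesis F (y + of_int k))) \<le> (LINT p|lborel. norm (F p) * C)" .
  qed
qed

lemma stft_gauss_eq_fourier:
  "stft gauss f x \<xi> = (LINT t|lborel. (f t * gauss (t - x)) * wave (- (\<xi> * t)))"
  unfolding stft_def L2_inner_def tf_shift_def translate_def modulate_eq_wave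
  by (simp add: cnj_wave mult_ac)

lemma integral_gauss_square:
  shows "(LINT x|lborel. gauss (t - x) * gauss (t - x)) = (LINT x|lborel. gauss x * gauss x)"
    and "(LINT x|lborel. gauss x * gauss x) \<noteq> 0"
proof -
  show "(LINT x|lborel. gauss (t - x) * gauss (t - x)) = (LINT x|lborel. gauss x * gauss x)"
    using lborel_integral_real_affine[of "-1" "\<lambda>x. gauss x * gauss x" t] by simp
  have eq: "(\<lambda>x. gauss x * gauss x) = (\<lambda>x. of_real (exp (- (2 * pi) * x\<^sup>2)))"
    by (auto simp: gauss_def simp flip: exp_add of_real_mult)
  have int: "integrable lborel (\<lambda>x. exp (- (2 * pi) * x\<^sup>2))"
    by (rule integrable_exp_neg_square) simp
  have "(LINT x|lborel. exp (- (2 * pi) * x\<^sup>2)) \<noteq> 0"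
  proof
    assume "(LINT x|lborel. exp (- (2 * pi) * x\<^sup>2)) = 0"
    then have "AE x::real in lborel. exp (- (2 * pi) * x\<^sup>2) = 0"
      using integral_nonneg_eq_0_iff_AE[OF int] by simp
    then have "ae_filter lborel = (bot :: real filter)"
      by (simp add: eventually_False)
    then show False
      by (simp add: ae_filter_eq_bot_iff)
  qed
  then show "(LINT x|lborel. gauss x * gauss x) \<noteq> 0"
    unfolding eq integral_complex_of_real by simp
qed

text \<open>For almost every \<open>x\<close> the slice \<open>V(x, \<cdot>)\<close> is integrable and is the Fourier transform of
\<open>t \<mapsto> f t * gauss (t - x)\<close>, so Fourier inversion applies. The exceptional null set of \<open>t\<close> depends on
\<open>x\<close>; exchanging the two quantifiers gives, for almost every \<open>t\<close>, an identity valid for almost every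
\<open>x\<close>, which is then integrated against \<open>gauss (t - x)\<close>.\<close>
theorem gabor_reconstruction:
  assumes f: "f \<in> S0"
  shows "AE t in lborel. f t = gabor_synthesis (\<lambda>(x, \<xi>). stft gauss f x \<xi>) t / (LINT s|lborel. gauss s * gauss s)"
proof -
  define F where "F = (\<lambda>(x, \<xi>). stft gauss f x \<xi>)"
  have f2: "f \<in> L2" and F: "integrable lborel F"
    using f by (simp_all add: S0_def F_def)
  then have F': "integrable (lborel \<Otimes>\<^sub>M lborel) F"
    by (simp add: lborel_prod)
  note [measurable] = borel_measurable_integrable[OF F']
  have [measurable]: "f \<in> borel_measurable borel"
    using f2 by (simp add: L2_def)
  have "AE x in lborel. AE t in lborel. f t * gauss (t - x) = (LINT \<xi>|lborel. F (x, \<xi>) * wave (\<xi> * t))"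
    using lborel_pair.AE_integrable_fst'[OF F']
  proof eventually_elim
    case (elim x)
    have "integrable lborel (\<lambda>t. f t * gauss (t - x))"
      using L2_mult_integrable[OF f2 L2_translate[OF gauss_L2, of x]] by (simp add: translate_def)
    from fourier_inversion[OF this] elim show ?case
      by (simp add: F_def stft_gauss_eq_fourier)
  qed
  moreover have "{p \<in> space (lborel \<Otimes>\<^sub>M lborel). f (snd p) * gauss (snd p - fst p)
      = (LINT \<xi>|lborel. F (fst p, \<xi>) * wave (\<xi> * snd p))} \<in> sets (lborel \<Otimes>\<^sub>M lborel)"
    by measurable
  ultimately have "AE t in lborel. AE x in lborel.
      f t * gauss (t - x) = (LINT \<xi>|lborel. F (x, \<xi>) * wave (\<xi> * t))"
    using lborel_pair.AE_commute[where P="\<lambda>x t. f t * gauss (t - x) = (LINT \<xi>|lborel. F (x, \<xi>) * wave (\<xi> * t))"]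
    by blast
  then show ?thesis
  proof eventually_elim
    case (elim t)
    have int: "integrable (lborel \<Otimes>\<^sub>M lborel) (\<lambda>p. F p * (wave (snd p * t) * gauss (t - fst p)))"
      using gabor_synthesis_integrable[OF F] by (simp add: lborel_prod)
    have "f t * (LINT s|lborel. gauss s * gauss s) = (LINT x|lborel. (f t * gauss (t - x)) * gauss (t - x))"
      unfolding integral_gauss_square(1)[of t, symmetric] by (simp add: mult.assoc)
    also have "\<dots> = (LINT x|lborel. (LINT \<xi>|lborel. F (x, \<xi>) * wave (\<xi> * t)) * gauss (t - x))"
      by (rule integral_cong_AE) (use elim in \<open>auto elim!: eventually_mono\<close>)
    also have "\<dots> = (LINT x|lborel. LINT \<xi>|lborel. F (x, \<xi>) * (wave (\<xi> * t) * gauss (t - x)))"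
      by (simp flip: mult.assoc)
    also have "\<dots> = gabor_synthesis F t"
      using lborel_pair.integral_fst'[OF int] by (simp add: gabor_synthesis_def lborel_prod)
    finally show ?case
      using integral_gauss_square(2) by (simp add: F_def field_simps)
  qed
qed

lemma continuous_AE_eq_imp_eq:
  fixes g h :: "real \<Rightarrow> complex"
  assumes "continuous_on UNIV g" "continuous_on UNIV h" "AE t in lborel. g t = h t"
  shows "g = h"
proof -
  have "open {t. g t \<noteq> h t}"
    using assms(1,2) by (rule open_Collect_neq)
  moreover have "negligible {t. g t \<noteq> h t}"
    using AE_completion[OF assms(3)] by (simp add: negligible_iff_null_sets completion.AE_iff_null_sets)
  ultimately have "{t. g t \<noteq> h t} = {}"
    using open_not_negligible by blast
  then show ?thesis by auto
qed

lemma cont_rep_eqI: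
  assumes "continuous_on UNIV h" "AE t in lborel. h t = g t"
  shows "cont_rep g = h"
  unfolding cont_rep_def
proof (rule the_equality)
  fix h' assume h': "continuous_on UNIV h' \<and> (AE t in lborel. h' t = g t)"
  have "AE t in lborel. h' t = h t"
    using assms(2) conjunct2[OF h'] by eventually_elim simp
  then show "h' = h"
    using continuous_AE_eq_imp_eq h' assms(1) by blast
qed (use assms in simp)

theorem S0_continuous_representative:
  assumes f: "f \<in> S0"
  shows "continuous_on UNIV (cont_rep f)"
    and "AE t in lborel. cont_rep f t = f t"
    and "\<exists>C. \<forall>y (K :: int set). finite K \<longrightarrow> (\<Sum>k\<in>K. norm (cont_rep f (y + of_int k))) \<le> C"
proof -
  define c where "c = (LINT s|lborel. gauss s * gauss s)"
  define F where "F = (\<lambda>(x, \<xi>). stft gauss f x \<xi>)"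
  define h where "h t = gabor_synthesis F t / c" for t
  have F: "integrable lborel F"
    using f by (simp add: S0_def F_def)
  have c: "c \<noteq> 0"
    using integral_gauss_square(2) by (simp add: c_def)
  have cont: "continuous_on UNIV h"
    unfolding h_def using c by (intro continuous_intros continuous_on_gabor_synthesis F) auto
  have AE: "AE t in lborel. h t = f t"
    using gabor_reconstruction[OF f] by eventually_elim (simp add: h_def c_def F_def)
  have rep: "cont_rep f = h"
    by (rule cont_rep_eqI[OF cont AE])
  from cont AE show "continuous_on UNIV (cont_rep f)" "AE t in lborel. cont_rep f t = f t"
    by (simp_all add: rep)
  obtain C where C: "\<And>y (K :: int set). finite K \<Longrightarrow> (\<Sum>k\<in>K. norm (gabor_synthesis F (y + of_int k))) \<le> C"
    using gabor_synthesis_lattice_sum_bounded[OF F] by blast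
  have "(\<Sum>k\<in>K. norm (h (y + of_int k))) \<le> C / norm c" if "finite K" for y and K :: "int set"
    using C[OF that, of y] c by (simp add: h_def norm_divide divide_right_mono flip: sum_divide_distrib)
  then show "\<exists>C. \<forall>y (K :: int set). finite K \<longrightarrow> (\<Sum>k\<in>K. norm (cont_rep f (y + of_int k))) \<le> C"
    unfolding rep by blast
qed

section \<open>Time-frequency shifts on the Feichtinger algebra\<close>

text \<open>The short-time Fourier transform is covariant: a time-frequency shift of \<open>g\<close> translates it in the
plane and multiplies it by a function of modulus one.\<close>
lemma S0_tf_shift:
  assumes g: "g \<in> S0"
  shows "tf_shift x \<xi> g \<in> S0"
proof -
  define F where "F = (\<lambda>(y, \<eta>). stft gauss g y \<eta>)"
  have F: "integrable lborel F"
    using g by (simp add: S0_def F_def)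
  \<comment> \<open>Substitute \<open>t = x + s\<close> and collect the factors that do not depend on \<open>s\<close>.\<close>
  have cov: "stft gauss (tf_shift x \<xi> g) y \<eta> = wave ((\<xi> - \<eta>) * x) * F (- x + y, - \<xi> + \<eta>)" for y \<eta>
  proof -
    have "stft gauss (tf_shift x \<xi> g) y \<eta>
        = (LINT s|lborel. (wave (\<xi> * (x + s)) * g s * gauss (x + s - y)) * wave (- (\<eta> * (x + s))))"
      unfolding stft_gauss_eq_fourier
      by (subst lborel_integral_real_affine[where c=1 and t=x])
         (simp_all add: tf_shift_def translate_def modulate_eq_wave)
    also have "\<dots> = (LINT s|lborel. wave ((\<xi> - \<eta>) * x) * ((g s * gauss (s - (- x + y))) * wave (- ((- \<xi> + \<eta>) * s))))"
    proof (intro Bochner_Integration.integral_cong refl)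
      fix s
      have "wave (\<xi> * (x + s)) * wave (- (\<eta> * (x + s))) = wave ((\<xi> - \<eta>) * x) * wave (- ((- \<xi> + \<eta>) * s))"
        unfolding wave_add[symmetric] by (simp add: algebra_simps)
      then have w: "wave (\<xi> * (x + s)) * wave (- (\<eta> * (x + s))) * c
          = wave ((\<xi> - \<eta>) * x) * wave (- ((- \<xi> + \<eta>) * s)) * c" for c
        by simp
      have "x + s - y = s - (- x + y)" by simp
      then show "wave (\<xi> * (x + s)) * g s * gauss (x + s - y) * wave (- (\<eta> * (x + s)))
          = wave ((\<xi> - \<eta>) * x) * ((g s * gauss (s - (- x + y))) * wave (- ((- \<xi> + \<eta>) * s)))"
        using w[of "g s * gauss (x + s - y)"] by (simp only: mult_ac)
    qed
    finally show ?thesis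
      by (simp only: integral_mult_right_zero F_def prod.case stft_gauss_eq_fourier)
  qed
  have "integrable (distr lborel borel ((+) (- x, - \<xi>))) F"
    using F by (simp only: lborel_distr_plus)
  then have "integrable lborel (\<lambda>p. F ((- x, - \<xi>) + p))"
    by (subst (asm) integrable_distr_eq) (use F in auto)
  then have "integrable lborel (\<lambda>p. F ((- x, - \<xi>) + p) * wave ((\<xi> - snd p) * x))"
    by (rule integrable_mult_bounded[where B=1])
       (auto intro!: borel_measurable_continuous_onI continuous_intros)
  then show ?thesis
    using g L2_tf_shift[of g x \<xi>]
    by (simp add: S0_def cov case_prod_unfold plus_prod_def mult.commute)
qed

lemma cont_rep_tf_shift:
  assumes g: "g \<in> S0"
  shows "cont_rep (tf_shift x \<xi> g) = tf_shift x \<xi> (cont_rep g)"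
proof (rule cont_rep_eqI)
  note h = S0_continuous_representative[OF g]
  have "continuous_on UNIV (\<lambda>t. cont_rep g (t - x))"
    by (rule continuous_on_compose2[OF h(1)]) (auto intro!: continuous_intros)
  then show "continuous_on UNIV (tf_shift x \<xi> (cont_rep g))"
    unfolding tf_shift_def modulate_eq_wave[abs_def] translate_def by (intro continuous_intros)
  have "{t. cont_rep g t = g t} \<in> sets borel"
  proof -
    have [measurable]: "cont_rep g \<in> borel_measurable borel" "g \<in> borel_measurable borel"
      using h(1) g by (auto simp: S0_def L2_def intro: borel_measurable_continuous_onI)
    show ?thesis by measurable
  qed
  then have "AE t in lborel. cont_rep g (- x + 1 * t) = g (- x + 1 * t)"
    by (intro AE_borel_affine h(2)) (auto simp: pred_def)
  then show "AE t in lborel. tf_shift x \<xi> (cont_rep g) t = tf_shift x \<xi> g t"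
    by (auto simp: tf_shift_def modulate_eq_wave translate_def)
qed

section \<open>Delta trains as trigonometric series\<close>

text \<open>The symmetric partial sums of the series that represents, at \<open>p = (x, \<xi>)\<close>, the short-time Fourier
transform of the train supported on \<open>y + \<int>\<close> with respect to a continuous window \<open>h\<close>.\<close>
definition train_partial :: "(real \<Rightarrow> complex) \<Rightarrow> real \<Rightarrow> nat \<Rightarrow> real \<times> real \<Rightarrow> complex" where
  "train_partial h y K p =
     (\<Sum>k\<in>{- int K..int K}. wave (- (snd p * (y + of_int k))) * cnj (h (y + of_int k - fst p)))"

lemma filterlim_symmetric_intervals:
  "filterlim (\<lambda>K. {- int K..int K}) (finite_subsets_at_top UNIV) sequentially"
  unfolding filterlim_finite_subsets_at_top
proof (intro allI impI)
  fix X :: "int set" assume "finite X \<and> X \<subseteq> UNIV"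
  then have X: "finite X" by simp
  define M where "M = nat (\<Sum>k\<in>X. \<bar>k\<bar>)"
  have "X \<subseteq> {- int K..int K}" if "K \<ge> M" for K
  proof
    fix k assume "k \<in> X"
    then have "\<bar>k\<bar> \<le> (\<Sum>k\<in>X. \<bar>k\<bar>)"
      by (intro member_le_sum X) auto
    then show "k \<in> {- int K..int K}"
      using that unfolding M_def by auto
  qed
  then show "\<forall>\<^sub>F K in sequentially. finite {- int K..int K} \<and> X \<subseteq> {- int K..int K} \<and> {- int K..int K} \<subseteq> UNIV"
    by (auto simp: eventually_sequentially)
qed

text \<open>An infinite sum over the integers is a limit over finite subsets, with value \<open>0\<close> by convention when
the limit does not exist. The bounded lattice sums of the window make the series absolutely summable,
so that it is the limit of its symmetric partial sums.\<close>
lemma train_partial_tendsto_delta_train: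
  assumes g: "g \<in> S0"
  shows "(\<lambda>K. train_partial (cont_rep g) (real n / real N) K (x, \<xi>))
      \<longlonglongrightarrow> delta_train N n (tf_shift x \<xi> g)"
proof -
  define y where "y = real n / real N"
  define f where "f k = delta (y + of_int k) (tf_shift x \<xi> g)" for k
  have f: "f k = wave (- (\<xi> * (y + of_int k))) * cnj (cont_rep g (y + of_int k - x))" for k
    unfolding f_def delta_def using S0_tf_shift[OF g] cont_rep_tf_shift[OF g]
    by (simp add: tf_shift_def modulate_eq_wave translate_def cnj_wave)
  obtain C where C: "\<And>y (K :: int set). finite K \<Longrightarrow> (\<Sum>k\<in>K. norm (cont_rep g (y + of_int k))) \<le> C"
    using S0_continuous_representative(3)[OF g] by blast
  have "(\<lambda>k. norm (f k)) summable_on UNIV"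
  proof (rule nonneg_bdd_above_summable_on)
    show "bdd_above (sum (\<lambda>k. norm (f k)) ` {F. F \<subseteq> UNIV \<and> finite F})"
    proof (rule bdd_aboveI2)
      fix K :: "int set" assume "K \<in> {F. F \<subseteq> UNIV \<and> finite F}"
      then have "(\<Sum>k\<in>K. norm (cont_rep g ((y - x) + of_int k))) \<le> C"
        using C by blast
      then show "(\<Sum>k\<in>K. norm (f k)) \<le> C"
        by (simp add: f norm_mult diff_add_eq)
    qed
  qed auto
  then have "(f has_sum infsum f UNIV) UNIV"
    by (rule abs_summable_summable[THEN has_sum_infsum])
  then have "(\<lambda>K. sum f {- int K..int K}) \<longlonglongrightarrow> infsum f UNIV"
    unfolding has_sum_def by (rule filterlim_compose[OF _ filterlim_symmetric_intervals])
  moreover have "infsum f UNIV = delta_train N n (tf_shift x \<xi> g)"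
    by (simp add: delta_train_def f_def[abs_def] y_def)
  ultimately show ?thesis
    by (simp add: train_partial_def f y_def)
qed

lemma norm_train_partial_bounded:
  assumes g: "g \<in> S0"
  obtains C where "\<And>K p. norm (train_partial (cont_rep g) y K p) \<le> C"
proof -
  obtain C where C: "\<And>y (K :: int set). finite K \<Longrightarrow> (\<Sum>k\<in>K. norm (cont_rep g (y + of_int k))) \<le> C"
    using S0_continuous_representative(3)[OF g] by blast
  have "norm (train_partial (cont_rep g) y K p) \<le> C" for K p
  proof -
    have "norm (train_partial (cont_rep g) y K p)
        \<le> (\<Sum>k\<in>{- int K..int K}. norm (cont_rep g ((y - fst p) + of_int k)))"
      unfolding train_partial_def
      by (rule order_trans[OF norm_sum]) (simp add: norm_mult diff_add_eq)
    also have "\<dots> \<le> C" by (rule C) simp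
    finally show ?thesis .
  qed
  then show thesis by (rule that)
qed

lemma continuous_on_train_partial:
  assumes "continuous_on UNIV h"
  shows "continuous_on UNIV (train_partial h y K)"
proof -
  have "continuous_on UNIV (\<lambda>p :: real \<times> real. h (y + of_int k - fst p))" for k
    by (rule continuous_on_compose2[OF assms]) (auto intro!: continuous_intros)
  then show ?thesis
    unfolding train_partial_def[abs_def] by (intro continuous_intros)
qed

section \<open>Orthogonality of delta trains\<close>

lemma integral_tensor:
  fixes f g :: "real \<Rightarrow> complex"
  assumes "integrable lborel f" "integrable lborel g"
  shows "integrable lborel (\<lambda>p. f (fst p) * g (snd p))"
    and "(LINT p|lborel. f (fst p) * g (snd p)) = (LINT x|lborel. f x) * (LINT y|lborel. g y)"
proof -
  have int: "integrable (lborel \<Otimes>\<^sub>M lborel) (\<lambda>p. f (fst p) * g (snd p))"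
    using integrable_tensor[OF assms] by (simp add: case_prod_unfold)
  then show "integrable lborel (\<lambda>p. f (fst p) * g (snd p))"
    by (simp add: lborel_prod)
  show "(LINT p|lborel. f (fst p) * g (snd p)) = (LINT x|lborel. f x) * (LINT y|lborel. g y)"
    using lborel_pair.integral_fst'[OF int] by (simp add: lborel_prod)
qed

lemma integral_wave_period:
  fixes j :: int
  assumes N: "N \<ge> 1"
  shows "(LINT \<xi>|lborel. indicator {0..real N} \<xi> *\<^sub>R wave (\<xi> * (of_int j / real N))) = (if j = 0 then of_nat N else 0)"
proof (cases "j = 0")
  case True
  then show ?thesis by (simp add: scaleR_conv_of_real)
next
  case False
  \<comment> \<open>A nontrivial character has the primitive \<open>\<xi> \<mapsto> exp (\<xi> z) / z\<close>, which is periodic with period \<open>N\<close>.\<close>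
  define z where "z = 2 * of_real pi * \<i> * of_real (of_int j / real N)"
  have z: "z \<noteq> 0" using False N by (simp add: z_def)
  have w: "wave (\<xi> * (of_int j / real N)) = exp (of_real \<xi> * z)" for \<xi>
    by (simp add: wave_def cis_conv_exp z_def mult_ac)
  have "((\<lambda>w. exp (w * z) / z) has_field_derivative exp (of_real \<xi> * z)) (at (of_real \<xi>))" for \<xi>
    using z by (auto intro!: derivative_eq_intros)
  then have "((\<lambda>\<xi>. exp (of_real \<xi> * z) / z) has_vector_derivative exp (of_real \<xi> * z)) (at \<xi> within {0..real N})" for \<xi>
    by (rule has_vector_derivative_real_field)
  then have "(LINT \<xi>|lborel. indicator {0..real N} \<xi> *\<^sub>R exp (of_real \<xi> * z))
      = exp (of_real (real N) * z) / z - exp (of_real 0 * z) / z"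
    by (intro integral_FTC_Icc) (auto intro!: continuous_intros)
  also have "exp (of_real (real N) * z) = 1"
    using w[of "real N"] wave_of_int[of j] N by simp
  finally show ?thesis
    using False unfolding w by simp
qed

text \<open>The map \<open>x \<mapsto> y + k - x\<close> sends \<open>{0..<1}\<close> to \<open>{y + k - 1<..y + k}\<close>, the set of all \<open>t\<close> with
\<open>\<lceil>t - y\<rceil> = k\<close>. These sets partition the line, and the finitely many with \<open>\<bar>k\<bar> \<le> K\<close> exhaust it.\<close>
lemma sum_unit_intervals_tendsto_integral:
  fixes q :: "real \<Rightarrow> complex"
  assumes q: "integrable lborel q"
  shows "(\<lambda>K. \<Sum>k\<in>{- int K..int K}. LINT x|lborel. indicator {0..1} x *\<^sub>R q (y + of_int k - x))
      \<longlonglongrightarrow> (LINT t|lborel. q t)"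
proof -
  note [measurable] = borel_measurable_integrable[OF q]
  define I where "I k = {t. \<lceil>t - y\<rceil> = k}" for k :: int
  have I: "I k = {y + of_int k - 1<..y + of_int k}" for k
    by (auto simp: I_def ceiling_eq_iff)
  have I_int: "integrable lborel (\<lambda>t. indicator (I k) t *\<^sub>R q t)" for k
    by (intro integrable_mult_indicator q) (simp add: I)
  have shift: "(LINT x|lborel. indicator {0..1} x *\<^sub>R q (y + of_int k - x)) = (LINT t|lborel. indicator (I k) t *\<^sub>R q t)" for k
  proof -
    \<comment> \<open>The indicators differ only at \<open>x = 1\<close>, which is the excluded left endpoint of \<open>I k\<close>.\<close>
    have "(LINT x|lborel. indicator {0..1} x *\<^sub>R q (y + of_int k - x))
        = (LINT x|lborel. indicator (I k) (y + of_int k - x) *\<^sub>R q (y + of_int k - x))"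
    proof (rule integral_cong_AE)
      show "AE x in lborel. indicator {0..1} x *\<^sub>R q (y + of_int k - x)
          = indicator (I k) (y + of_int k - x) *\<^sub>R q (y + of_int k - x)"
        using AE_lborel_singleton[of 1] by eventually_elim (auto simp: I indicator_def)
    qed (simp_all add: I)
    also have "\<dots> = (LINT t|lborel. indicator (I k) t *\<^sub>R q t)"
      using lborel_integral_real_affine[of "-1" "\<lambda>t. indicator (I k) t *\<^sub>R q t" "y + of_int k"] by simp
    finally show ?thesis .
  qed
  have sum: "(\<Sum>k\<in>{- int K..int K}. indicator (I k) t *\<^sub>R q t)
      = (if \<lceil>t - y\<rceil> \<in> {- int K..int K} then q t else 0)" for K t
  proof -
    have "(\<Sum>k\<in>{- int K..int K}. indicator (I k) t *\<^sub>R q t)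
        = (\<Sum>k\<in>{- int K..int K}. if \<lceil>t - y\<rceil> = k then q t else 0)"
      by (intro sum.cong refl) (auto simp: I_def)
    then show ?thesis by simp
  qed
  have "(\<lambda>K. LINT t|lborel. (\<Sum>k\<in>{- int K..int K}. indicator (I k) t *\<^sub>R q t)) \<longlonglongrightarrow> (LINT t|lborel. q t)"
  proof (rule integral_dominated_convergence[where w="\<lambda>t. norm (q t)"])
    show "AE t in lborel. (\<lambda>K. \<Sum>k\<in>{- int K..int K}. indicator (I k) t *\<^sub>R q t) \<longlonglongrightarrow> q t"
    proof (rule AE_I2, rule tendsto_eventually)
      fix t
      show "\<forall>\<^sub>F K in sequentially. (\<Sum>k\<in>{- int K..int K}. indicator (I k) t *\<^sub>R q t) = q t"
        unfolding sum using eventually_ge_at_top[of "nat \<bar>\<lceil>t - y\<rceil>\<bar>"]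
        by eventually_elim auto
    qed
    show "AE t in lborel. norm (\<Sum>k\<in>{- int K..int K}. indicator (I k) t *\<^sub>R q t) \<le> norm (q t)" for K
      unfolding sum by simp
    have [measurable]: "I k \<in> sets borel" for k
      by (simp add: I)
    show "(\<lambda>t. \<Sum>k\<in>{- int K..int K}. indicator (I k) t *\<^sub>R q t) \<in> borel_measurable lborel" for K
      by measurable
  qed (use q in auto)
  then show ?thesis
    by (subst (asm) Bochner_Integration.integral_sum) (simp_all add: I_int shift)
qed

lemma lattice_frequency_eq_0_iff:
  fixes k l :: int
  assumes "n < N" "m < N"
  shows "(int m - int n) + int N * (l - k) = 0 \<longleftrightarrow> n = m \<and> k = l"
proof
  assume *: "(int m - int n) + int N * (l - k) = 0"
  then have "int N dvd int m - int n"
    by (metis add_eq_0_iff dvd_minus_iff dvd_triv_left)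
  then have "n = m"
    using assms dvd_imp_le_int[of "int m - int n" "int N"] by linarith
  then show "n = m \<and> k = l" using * assms by simp
qed auto

text \<open>A product of two partial sums is a finite sum of terms \<open>A k l x * B k l \<xi>\<close>, where \<open>B k l\<close> has
frequency \<open>((m - n) + N (l - k)) / N\<close>. Its integral over the period \<open>[0, N]\<close> vanishes unless this
frequency is zero, that is unless \<open>n = m\<close> and \<open>k = l\<close>.\<close>
lemma set_integral_train_partial:
  assumes N: "N \<ge> 1" and n: "n < N" and m: "m < N"
    and h1: "continuous_on UNIV h1" and h2: "continuous_on UNIV h2"
  shows "(LINT p:{0..1} \<times> {0..real N}|lborel.
            train_partial h1 (real n / real N) K p * cnj (train_partial h2 (real m / real N) K p))
       = (if n = m then of_nat N * (\<Sum>k\<in>{- int K..int K}. LINT x|lborel.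
            indicator {0..1} x *\<^sub>R (h2 (real n / real N + of_int k - x) * cnj (h1 (real n / real N + of_int k - x)))) else 0)"
proof -
  define y z where "y = real n / real N" and "z = real m / real N"
  let ?K = "{- int K..int K}"
  define A where "A k l x = indicator {0..1} x *\<^sub>R (h2 (z + of_int l - x) * cnj (h1 (y + of_int k - x)))" for k l x
  define B where "B k l \<xi> = indicator {0..real N} \<xi> *\<^sub>R wave (\<xi> * (of_int ((int m - int n) + int N * (l - k)) / real N))" for k l \<xi>
  have A: "integrable lborel (A k l)" for k l
  proof -
    have "continuous_on UNIV (\<lambda>x. h2 (z + of_int l - x))" "continuous_on UNIV (\<lambda>x. h1 (y + of_int k - x))"
      by (auto intro!: continuous_on_compose2[OF h1] continuous_on_compose2[OF h2] continuous_intros)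
    then have "continuous_on {0..1} (\<lambda>x. h2 (z + of_int l - x) * cnj (h1 (y + of_int k - x)))"
      by (intro continuous_intros; elim continuous_on_subset; simp)
    from borel_integrable_compact[OF _ this] show ?thesis by (simp add: A_def[abs_def])
  qed
  have B: "integrable lborel (B k l)" for k l
    unfolding B_def[abs_def] by (intro borel_integrable_compact continuous_intros) auto
  have split: "indicator ({0..1} \<times> {0..real N}) p *\<^sub>R (train_partial h1 y K p * cnj (train_partial h2 z K p))
      = (\<Sum>k\<in>?K. \<Sum>l\<in>?K. A k l (fst p) * B k l (snd p))" for p
  proof -
    have "- (\<xi> * (y + of_int k)) + - (- (\<xi> * (z + of_int l)))
        = \<xi> * (of_int ((int m - int n) + int N * (l - k)) / real N)" for \<xi> k l
      using N by (simp add: y_def z_def field_simps)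
    then have w: "wave (- (snd p * (y + of_int k))) * cnj (wave (- (snd p * (z + of_int l))))
        = wave (snd p * (of_int ((int m - int n) + int N * (l - k)) / real N))" for k l
      unfolding cnj_wave wave_add[symmetric] by (rule arg_cong)
    have "A k l (fst p) * B k l (snd p) = indicator ({0..1} \<times> {0..real N}) p *\<^sub>R
        ((wave (- (snd p * (y + of_int k))) * cnj (h1 (y + of_int k - fst p)))
          * cnj (wave (- (snd p * (z + of_int l))) * cnj (h2 (z + of_int l - fst p))))" for k l
      unfolding A_def B_def w[symmetric] by (auto simp: indicator_def mem_Times_iff)
    then show ?thesis
      by (simp add: train_partial_def sum_product scaleR_sum_right)
  qed
  have "(LINT p:{0..1} \<times> {0..real N}|lborel. train_partial h1 y K p * cnj (train_partial h2 z K p))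
      = (\<Sum>k\<in>?K. \<Sum>l\<in>?K. (LINT x|lborel. A k l x) * (LINT \<xi>|lborel. B k l \<xi>))"
    unfolding set_lebesgue_integral_def split
    by (simp add: Bochner_Integration.integral_sum Bochner_Integration.integrable_sum integral_tensor[OF A B])
  also have "\<dots> = (\<Sum>k\<in>?K. \<Sum>l\<in>?K. if k = l then (if n = m then (LINT x|lborel. A k k x) * of_nat N else 0) else 0)"
    unfolding B_def integral_wave_period[OF N] lattice_frequency_eq_0_iff[OF n m]
    by (intro sum.cong refl) auto
  also have "\<dots> = (if n = m then of_nat N * (\<Sum>k\<in>?K. LINT x|lborel. A k k x) else 0)"
    by (simp add: sum_distrib_left mult.commute)
  finally show ?thesis
    by (auto simp: A_def[abs_def] y_def z_def)
qed

lemma borel_measurable_cnj [measurable]: "cnj \<in> borel_measurable borel"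
  by (intro borel_measurable_continuous_onI continuous_intros)

lemma L2_inner_cont_rep:
  assumes g1: "g1 \<in> S0" and g2: "g2 \<in> S0"
  shows "integrable lborel (\<lambda>t. cont_rep g2 t * cnj (cont_rep g1 t))"
    and "(LINT t|lborel. cont_rep g2 t * cnj (cont_rep g1 t)) = L2_inner g2 g1"
proof -
  note h1 = S0_continuous_representative[OF g1] and h2 = S0_continuous_representative[OF g2]
  have [measurable]: "cont_rep g1 \<in> borel_measurable borel" "cont_rep g2 \<in> borel_measurable borel"
    using h1(1) h2(1) by (auto intro: borel_measurable_continuous_onI)
  have [measurable]: "g1 \<in> borel_measurable borel" "g2 \<in> borel_measurable borel"
    using g1 g2 by (auto simp: S0_def L2_def)
  have "(\<lambda>t. cnj (g1 t)) \<in> borel_measurable borel"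
    by measurable
  then have g: "g2 \<in> L2" "(\<lambda>t. cnj (g1 t)) \<in> L2"
    using g1 g2 by (auto simp: S0_def L2_def)
  have AE: "AE t in lborel. cont_rep g2 t * cnj (cont_rep g1 t) = g2 t * cnj (g1 t)"
    using h1(2) h2(2) by eventually_elim simp
  show "integrable lborel (\<lambda>t. cont_rep g2 t * cnj (cont_rep g1 t))"
    using L2_mult_integrable[OF g] by (subst integrable_cong_AE[OF _ _ AE]) auto
  show "(LINT t|lborel. cont_rep g2 t * cnj (cont_rep g1 t)) = L2_inner g2 g1"
    unfolding L2_inner_def by (rule integral_cong_AE[OF _ _ AE]) auto
qed

text \<open>Both sides are limits of their counterparts for symmetric partial sums: the left-hand side by
dominated convergence on the bounded domain, the partial sums being uniformly bounded; the
right-hand side because the diagonal terms exhaust the integral over the line.\<close>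
theorem delta_train_orthogonality:
  assumes N: "N \<ge> 1" and n: "n < N" and m: "m < N" and g1: "g1 \<in> S0" and g2: "g2 \<in> S0"
  defines "T \<equiv> \<lambda>g n p. delta_train N n (tf_shift (fst p) (snd p) g)"
  shows "set_integrable lborel ({0..1} \<times> {0..real N}) (\<lambda>p. T g1 n p * cnj (T g2 m p))"
    and "(LINT p:{0..1} \<times> {0..real N}|lborel. T g1 n p * cnj (T g2 m p))
       = (if n = m then of_nat N * L2_inner g2 g1 else 0)"
proof -
  define y z where "y = real n / real N" and "z = real m / real N"
  define S1 S2 where "S1 = train_partial (cont_rep g1) y" and "S2 = train_partial (cont_rep g2) z"
  let ?Q = "{0..1::real} \<times> {0..real N}"
  note h1 = S0_continuous_representative[OF g1] and h2 = S0_continuous_representative[OF g2]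
  have lim1: "(\<lambda>K. S1 K p) \<longlonglongrightarrow> T g1 n p" and lim2: "(\<lambda>K. S2 K p) \<longlonglongrightarrow> T g2 m p" for p
    using train_partial_tendsto_delta_train[OF g1, of n N "fst p" "snd p"]
      train_partial_tendsto_delta_train[OF g2, of m N "fst p" "snd p"]
    by (simp_all add: S1_def S2_def T_def y_def z_def)
  have [measurable]: "S1 K \<in> borel_measurable borel" "S2 K \<in> borel_measurable borel" for K
    unfolding S1_def S2_def
    by (intro borel_measurable_continuous_onI continuous_on_train_partial h1(1) h2(1))+
  have [measurable]: "T g1 n \<in> borel_measurable borel" "T g2 m \<in> borel_measurable borel"
    by (rule borel_measurable_LIMSEQ_metric[of S1], simp, rule lim1)
       (rule borel_measurable_LIMSEQ_metric[of S2], simp, rule lim2)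
  have Q [measurable]: "?Q \<in> sets borel"
    by (intro borel_closed closed_Times) auto
  obtain C1 C2 where C: "\<And>K p. norm (S1 K p) \<le> C1" "\<And>K p. norm (S2 K p) \<le> C2"
    using norm_train_partial_bounded[OF g1] norm_train_partial_bounded[OF g2] unfolding S1_def S2_def by metis
  have "integrable lborel (indicator ?Q :: real \<times> real \<Rightarrow> real)"
    by (intro integrable_real_indicator)
       (auto simp: borel_prod emeasure_lborel_Icc_eq lborel.emeasure_pair_measure_Times ennreal_mult_less_top simp flip: lborel_prod)
  then have w: "integrable lborel (\<lambda>p. indicator ?Q p * (C1 * C2) :: real)"
    by (rule integrable_mult_left)
  have bound: "AE p in lborel. norm (indicator ?Q p *\<^sub>R (S1 K p * cnj (S2 K p))) \<le> indicator ?Q p * (C1 * C2)" for K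
    using mult_mono[OF C(1)[of K] C(2)[of K]] order_trans[OF norm_ge_zero C(1)[of K]]
    by (intro AE_I2) (auto simp: indicator_def norm_mult)
  have lim: "AE p in lborel. (\<lambda>K. indicator ?Q p *\<^sub>R (S1 K p * cnj (S2 K p))) \<longlonglongrightarrow> indicator ?Q p *\<^sub>R (T g1 n p * cnj (T g2 m p))"
    by (intro AE_I2 tendsto_intros lim1 lim2)
  have meas: "(\<lambda>p. indicator ?Q p *\<^sub>R (T g1 n p * cnj (T g2 m p))) \<in> borel_measurable lborel"
    "(\<lambda>p. indicator ?Q p *\<^sub>R (S1 K p * cnj (S2 K p))) \<in> borel_measurable lborel" for K
    by measurable
  show "set_integrable lborel ?Q (\<lambda>p. T g1 n p * cnj (T g2 m p))"
    unfolding set_integrable_def by (rule integrable_dominated_convergence[OF meas w lim bound])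
  have "(\<lambda>K. LINT p:?Q|lborel. S1 K p * cnj (S2 K p)) \<longlonglongrightarrow> (LINT p:?Q|lborel. T g1 n p * cnj (T g2 m p))"
    unfolding set_lebesgue_integral_def by (rule integral_dominated_convergence[OF meas w lim bound])
  moreover have "(\<lambda>K. LINT p:?Q|lborel. S1 K p * cnj (S2 K p)) \<longlonglongrightarrow> (if n = m then of_nat N * L2_inner g2 g1 else 0)"
    unfolding S1_def S2_def y_def z_def set_integral_train_partial[OF N n m h1(1) h2(1)]
    using sum_unit_intervals_tendsto_integral[OF L2_inner_cont_rep(1)[OF g1 g2], of "real n / real N"]
    unfolding L2_inner_cont_rep(2)[OF g1 g2] by (auto intro!: tendsto_mult_left)
  ultimately show "(LINT p:?Q|lborel. T g1 n p * cnj (T g2 m p)) = (if n = m then of_nat N * L2_inner g2 g1 else 0)"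
    by (rule LIMSEQ_unique)
qed

section \<open>The integral formula on the torus\<close>

lemma SN_coeff:
  assumes "\<phi> \<in> SN N"
  shows "train_comb N (SN_coeff N \<phi>) = \<phi>"
proof -
  have "\<exists>a. \<phi> = train_comb N a"
    using assms by (auto simp: SN_def)
  then have "\<phi> = train_comb N (SOME a. \<phi> = train_comb N a)"
    by (rule someI_ex)
  then show ?thesis
    unfolding SN_coeff_def by (rule sym)
qed

text \<open>The coefficients returned by \<open>SN_coeff\<close> represent the given distributions, so the formula follows from
the orthogonality of the delta trains by expanding both distributions.\<close>
theorem theorem9:
  fixes N :: nat and \<phi>1 \<phi>2 :: distribution and g1 g2 :: "real \<Rightarrow> complex"
  assumes "N \<ge> 1"
    and "\<phi>1 \<in> SN N" and "\<phi>2 \<in> SN N"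
    and "g1 \<in> S0" and "g2 \<in> S0"
  shows "set_integrable lborel ({0..1} \<times> {0..real N})
           (\<lambda>(x, \<xi>). stft_dual g1 \<phi>1 x \<xi> * cnj (stft_dual g2 \<phi>2 x \<xi>))
       \<and> (LINT (x, \<xi>) : {0..1} \<times> {0..real N} | lborel.
           stft_dual g1 \<phi>1 x \<xi> * cnj (stft_dual g2 \<phi>2 x \<xi>))
         = of_nat N * SN_inner N \<phi>1 \<phi>2 * L2_inner g2 g1"
proof -
  define a b where "a = SN_coeff N \<phi>1" and "b = SN_coeff N \<phi>2"
  define T where "T g n p = delta_train N n (tf_shift (fst p) (snd p) g)" for g n p
  let ?Q = "{0..1::real} \<times> {0..real N}"
  let ?f = "\<lambda>n m p. (a n * cnj (b m)) * (T g1 n p * cnj (T g2 m p))"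
  have \<phi>: "\<phi>1 = train_comb N a" "\<phi>2 = train_comb N b"
    using SN_coeff assms by (simp_all add: a_def b_def)
  have expand: "(\<lambda>(x, \<xi>). stft_dual g1 \<phi>1 x \<xi> * cnj (stft_dual g2 \<phi>2 x \<xi>)) = (\<lambda>p. \<Sum>n<N. \<Sum>m<N. ?f n m p)"
    by (auto simp: \<phi> stft_dual_def train_comb_def T_def sum_product mult_ac)
  note orth = delta_train_orthogonality[OF assms(1) _ _ assms(4,5), folded T_def]
  have int: "set_integrable lborel ?Q (?f n m)" if "n < N" "m < N" for n m
    using orth(1)[OF that] by (intro set_integrable_mult_right) simp
  have "(LINT p:?Q|lborel. (\<Sum>n<N. \<Sum>m<N. ?f n m p)) = (\<Sum>n<N. \<Sum>m<N. (LINT p:?Q|lborel. ?f n m p))"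
  proof -
    have "(LINT p:?Q|lborel. (\<Sum>n<N. \<Sum>m<N. ?f n m p)) = (\<Sum>n<N. (LINT p|lborel. (\<Sum>m<N. indicator ?Q p *\<^sub>R ?f n m p)))"
      using int unfolding set_lebesgue_integral_def set_integrable_def scaleR_sum_right
      by (intro Bochner_Integration.integral_sum Bochner_Integration.integrable_sum) simp
    also have "\<dots> = (\<Sum>n<N. \<Sum>m<N. (LINT p:?Q|lborel. ?f n m p))"
      using int unfolding set_lebesgue_integral_def set_integrable_def
      by (intro sum.cong refl Bochner_Integration.integral_sum) simp
    finally show ?thesis .
  qed
  also have "\<dots> = (\<Sum>n<N. \<Sum>m<N. if n = m then a n * cnj (b n) * (of_nat N * L2_inner g2 g1) else 0)"
    by (intro sum.cong refl) (auto simp: orth(2))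
  also have "\<dots> = of_nat N * SN_inner N \<phi>1 \<phi>2 * L2_inner g2 g1"
    by (simp add: SN_inner_def a_def b_def sum_distrib_left sum_distrib_right mult_ac)
  moreover have "set_integrable lborel ?Q (\<lambda>p. \<Sum>n<N. \<Sum>m<N. ?f n m p)"
    using int unfolding set_integrable_def scaleR_sum_right
    by (intro Bochner_Integration.integrable_sum) simp
  ultimately show ?thesis
    unfolding expand by simp
qed

end
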